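(* Fix $j\in\mathbb N$, $\Delta_j>0$ and $\alpha\in(0,1)$. Suppose that, as $m,n\to\infty$, $$\sqrt{m+n}\,\big(\hat D^{(j)}_{m,n}-D^{(j)},\ \hat V^{(j)}_{m,n}\big)\ \xrightarrow{\ \mathcal D\ }\ \Big(\zeta_j\,\mathbb B(1),\ \Big\{\zeta_j^2\int_0^1\lambda^2\big(\mathbb B(\lambda)-\lambda\mathbb B(1)\big)^2\,\nu(d\lambda)\Big\}^{1/2}\Big),$$ where $\{\mathbb B(\lambda)\}_{\lambda\in[0,1]}$ is a standard Brownian motion and $\zeta_j\ge 0$ is a constant which is strictly positive if $D^{(j)}>0$. Let $\hat{\mathbb W}^{(j)}_{m,n}=(\hat D^{(j)}_{m,n}-\Delta_j)/\hat V^{(j)}_{m,n}$ and let $q_{1-\alpha}$ be the $(1-\alpha)$-quantile of the distribution of $$\mathbb W=\frac{\mathbb B(1)}{\big\{\int_0^1\lambda^2(\mathbb B(\lambda)-\lambda\mathbb B(1))^2\,\nu(d\lambda)\big\}^{1/2}} .$$ Then the test that rejects $H_0^{(j)}:\ \|v_j^X-v_j^Y\|^2\le\Delta_j$ in favour of $H_1^{(j)}:\ \|v_j^X-v_j^Y\|^2>\Delta_j$ whenever $\hat{\mathbb W}^{(j)}_{m,n}>q_{1-\alpha}$ has asymptotic level $\alpha$ and is consistent. In particular, $$\lim_{m,n\to\infty}\mathbb P\big(\hat{\mathbb W}^{(j)}_{m,n}>q_{1-\alpha}\big)=\begin{cases}0 & \text{if } D^{(j)}<\Delta_j,\\ \alpha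 & \text{if } D^{(j)}=\Delta_j,\\ 1 & \text{if } D^{(j)}>\Delta_j.\end{cases}$$
   Context: $L^2([0,1])$ carries the inner product $\langle f,g\rangle=\int_0^1 f(t)g(t)\,dt$ and norm $\|\cdot\|$. $(X_t)_{t\in\mathbb Z}$ and $(Y_t)_{t\in\mathbb Z}$ are two independent stationary time series in $L^2([0,1])$ with $\mathbb E[X_t]=\mathbb E[Y_t]=0$, $\mathbb E\|X_t\|^2<\infty$, $\mathbb E\|Y_t\|^2<\infty$. Their covariance kernels are $C^X(s,t)=\mathbb E[X_0(s)X_0(t)]=\sum_{k\ge1}\tau_k^Xv_k^X(s)v_k^X(t)$ and $C^Y(s,t)=\mathbb E[Y_0(s)Y_0(t)]=\sum_{k\ge1}\tau_k^Yv_k^Y(s)v_k^Y(t)$, with ordered eigenvalues $\tau_1^X\ge\tau_2^X\ge\cdots$, $\tau_1^Y\ge\tau_2^Y\ge\cdots$ and orthonormal eigenfunctions $v_k^X$, $v_k^Y$ of the associated integral operators, with signs such that $\langle v_k^X,v_k^Y\rangle\ge0$ for all $k$. Put $D^{(j)}=\|v_j^X-v_j^Y\|^2$. From samples $X_1,\dots,X_m$ and $Y_1,\dots,Y_n$ define for $\lambda\in[0,1]$ $$\hat C_m^X(s,t,\lambda)=\frac1{\lfloor m\lambda\rfloor}\sum_{i=1}^{\lfloor m\lambda\rfloor}X_i(s)X_i(t),\qquad \hat C_n^Y(s,t,\lambda)=\frac1{\lfloor n\lambda\rfloor}\sum_{i=1}^{\lfloor n\lambda\rfloor}Y_i(s)Y_i(t),$$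 set equal to $0$ if $\lfloor m\lambda\rfloor<1$ (respectively $\lfloor n\lambda\rfloor<1$). Let $\hat v_j^X(\cdot,\lambda)$ and $\hat v_j^Y(\cdot,\lambda)$ be the unit-norm eigenfunctions of the corresponding integral operators belonging to the $j$th largest eigenvalues, with signs such that $\langle\hat v_j^X(\cdot,\lambda),\hat v_j^Y(\cdot,\lambda)\rangle\ge0$. Define $$\hat D^{(j)}_{m,n}(t,\lambda)=\lambda\big(\hat v_j^X(t,\lambda)-\hat v_j^Y(t,\lambda)\big),\qquad \hat D^{(j)}_{m,n}=\int_0^1\big(\hat D^{(j)}_{m,n}(t,1)\big)^2dt,$$ $$\hat V^{(j)}_{m,n}=\Big(\int_0^1\Big(\int_0^1(\hat D^{(j)}_{m,n}(t,\lambda))^2dt-\lambda^2\int_0^1(\hat D^{(j)}_{m,n}(t,1))^2dt\Big)^2\nu(d\lambda)\Big)^{1/2}.$$ Here $\nu$ is a probability measure on $(0,1]$ such that $\int_0^1\lambda^2(\mathbb B(\lambda)-\lambda\mathbb B(1))^2\,\nu(d\lambda)>0$ almost surely (i.e. $\nu$ is not the point mass at $1$). The event $\{\hat{\mathbb W}^{(j)}_{m,n}>q_{1-\alpha}\}$ is understood as $\{\hat D^{(j)}_{m,n}-\Delta_j>q_{1-\alpha}\hat V^{(j)}_{m,n}\}$ (relevant only when $\hat V^{(j)}_{m,n}=0$). Asymptotic level $\alpha$ means that the limiting rejection probability is at most $\alpha$ under $H_0^{(j)}$; consistent means that it tends to $1$ under $H_1^{(j)}$. *)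

theory Defs
  imports "HOL-Probability.Probability"
begin

subsection \<open>The space $L^2([0,1])$\<close>

text \<open>
  Elements of $L^2([0,1])$ are represented by square-integrable Borel functions on the unit
  interval; their values off the unit interval play no role, and equality of classes is
  equality almost everywhere.
\<close>

definition leb01 :: "real measure" where
  "leb01 = restrict_space lborel {0..1}"

definition L2 :: "(real \<Rightarrow> real) set" where
  "L2 = {f \<in> borel_measurable leb01. integrable leb01 (\<lambda>t. (f t)\<^sup>2)}"

definition L2_inner :: "(real \<Rightarrow> real) \<Rightarrow> (real \<Rightarrow> real) \<Rightarrow> real" where
  "L2_inner f g = (LINT t|leb01. f t * g t)"

definition L2_norm :: "(real \<Rightarrow> real) \<Rightarrow> real" where
  "L2_norm f = sqrt (L2_inner f f)"

text \<open>The Borel \<open>\<sigma>\<close>-algebra of the $L^2$ (semi)norm, generated by the norm-open sets.\<close>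

definition L2_borel :: "(real \<Rightarrow> real) measure" where
  "L2_borel = sigma L2
     {U. U \<subseteq> L2 \<and> (\<forall>f\<in>U. \<exists>e>0. \<forall>g\<in>L2. L2_norm (\<lambda>t. g t - f t) < e \<longrightarrow> g \<in> U)}"

subsection \<open>Time series in $L^2([0,1])$\<close>

text \<open>
  \<open>X k \<omega> t\<close> is the value at \<open>t\<close> of the path \<open>\<omega>\<close> of the \<open>k\<close>-th observation. Joint measurability
  in \<open>(\<omega>, t)\<close> makes the pointwise products in the covariance kernel random variables; every
  random element of $L^2([0,1])$ has such a version.
\<close>

definition L2_time_series :: "'a measure \<Rightarrow> (int \<Rightarrow> 'a \<Rightarrow> real \<Rightarrow> real) \<Rightarrow> bool" where
  "L2_time_series M X \<longleftrightarrow>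
     (\<forall>k. X k \<in> measurable M L2_borel) \<and>
     (\<forall>k. (\<lambda>(\<omega>, t). X k \<omega> t) \<in> borel_measurable (M \<Otimes>\<^sub>M leb01))"

abbreviation L2_seq_borel :: "(int \<Rightarrow> real \<Rightarrow> real) measure" where
  "L2_seq_borel \<equiv> Pi\<^sub>M UNIV (\<lambda>_. L2_borel)"

text \<open>Strict stationarity: the law of the whole series is invariant under time shifts.\<close>

definition stationary :: "'a measure \<Rightarrow> (int \<Rightarrow> 'a \<Rightarrow> real \<Rightarrow> real) \<Rightarrow> bool" where
  "stationary M X \<longleftrightarrow>
     (\<forall>h. distr M L2_seq_borel (\<lambda>\<omega> k. X (k + h) \<omega>) = distr M L2_seq_borel (\<lambda>\<omega> k. X k \<omega>))"

definition independent_series ::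
  "'a measure \<Rightarrow> (int \<Rightarrow> 'a \<Rightarrow> real \<Rightarrow> real) \<Rightarrow> (int \<Rightarrow> 'a \<Rightarrow> real \<Rightarrow> real) \<Rightarrow> bool" where
  "independent_series M X Y \<longleftrightarrow>
     prob_space.indep_var M L2_seq_borel (\<lambda>\<omega> k. X k \<omega>) L2_seq_borel (\<lambda>\<omega> k. Y k \<omega>)"

definition centred :: "'a measure \<Rightarrow> (int \<Rightarrow> 'a \<Rightarrow> real \<Rightarrow> real) \<Rightarrow> bool" where
  "centred M X \<longleftrightarrow> (\<forall>k. AE t in leb01. (LINT \<omega>|M. X k \<omega> t) = 0)"

definition finite_second_moments :: "'a measure \<Rightarrow> (int \<Rightarrow> 'a \<Rightarrow> real \<Rightarrow> real) \<Rightarrow> bool" where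
  "finite_second_moments M X \<longleftrightarrow> (\<forall>k. integrable M (\<lambda>\<omega>. (L2_norm (X k \<omega>))\<^sup>2))"

subsection \<open>Covariance kernels and their eigenfunctions\<close>

definition cov_kernel :: "'a measure \<Rightarrow> (int \<Rightarrow> 'a \<Rightarrow> real \<Rightarrow> real) \<Rightarrow> real \<Rightarrow> real \<Rightarrow> real" where
  "cov_kernel M X s t = (LINT \<omega>|M. X 0 \<omega> s * X 0 \<omega> t)"

text \<open>\<open>x\<close> is an observed path of the series; only \<open>x 1, \<dots>, x m\<close> enter.\<close>

definition emp_kernel :: "(int \<Rightarrow> real \<Rightarrow> real) \<Rightarrow> nat \<Rightarrow> real \<Rightarrow> real \<Rightarrow> real \<Rightarrow> real" where
  "emp_kernel x m l s t =
     (if \<lfloor>real m * l\<rfloor> < 1 then 0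
      else 1 / real_of_int \<lfloor>real m * l\<rfloor> * (\<Sum>i = 1..\<lfloor>real m * l\<rfloor>. x i s * x i t))"

text \<open>
  \<open>K(s,t) = \<Sum>k\<ge>1. \<tau> k * v k s * v k t\<close> in $L^2([0,1]^2)$, with the eigenvalues \<open>\<tau>\<close> of the integral
  operator of \<open>K\<close> in decreasing order, repeated by multiplicity, and orthonormal eigenfunctions
  \<open>v\<close>. Indices start at 1. If the operator has finite rank, the eigenvalues are eventually 0.
\<close>

definition eigensystem ::
  "(real \<Rightarrow> real \<Rightarrow> real) \<Rightarrow> (nat \<Rightarrow> real) \<Rightarrow> (nat \<Rightarrow> real \<Rightarrow> real) \<Rightarrow> bool" where
  "eigensystem K \<tau> v \<longleftrightarrow>
     (\<forall>k\<ge>1. v k \<in> L2) \<and>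
     (\<forall>k\<ge>1. \<forall>l\<ge>1. L2_inner (v k) (v l) = (if k = l then 1 else 0)) \<and>
     (\<forall>k\<ge>1. \<tau> (Suc k) \<le> \<tau> k) \<and>
     (\<forall>k\<ge>1. AE s in leb01. (LINT t|leb01. K s t * v k t) = \<tau> k * v k s) \<and>
     (\<lambda>N. LINT (s, t)|(leb01 \<Otimes>\<^sub>M leb01). (K s t - (\<Sum>k = 1..N. \<tau> k * v k s * v k t))\<^sup>2)
       \<longlonglongrightarrow> 0"

text \<open>
  The eigenvalue \<open>\<tau> j\<close> may be multiple or 0, so \<open>f\<close> need not be determined up to sign; every unit
  vector of the eigenspace is admitted.
\<close>

definition unit_eigenfunction ::
  "(real \<Rightarrow> real \<Rightarrow> real) \<Rightarrow> nat \<Rightarrow> (real \<Rightarrow> real) \<Rightarrow> bool" where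
  "unit_eigenfunction K j f \<longleftrightarrow>
     f \<in> L2 \<and> L2_norm f = 1 \<and>
     (\<exists>\<tau> v. eigensystem K \<tau> v \<and> (AE s in leb01. (LINT t|leb01. K s t * f t) = \<tau> j * f s))"

subsection \<open>The test statistic\<close>

text \<open>
  Here \<open>u l t\<close> and \<open>w l t\<close> stand for the estimated eigenfunctions $\hat v_j^X(t,\lambda)$ and
  $\hat v_j^Y(t,\lambda)$ at $\lambda = $ \<open>l\<close>, for fixed sample sizes and a fixed outcome.
\<close>

definition Dhat_fun ::
  "(real \<Rightarrow> real \<Rightarrow> real) \<Rightarrow> (real \<Rightarrow> real \<Rightarrow> real) \<Rightarrow> real \<Rightarrow> real \<Rightarrow> real" where
  "Dhat_fun u w t l = l * (u l t - w l t)"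

definition Dhat :: "(real \<Rightarrow> real \<Rightarrow> real) \<Rightarrow> (real \<Rightarrow> real \<Rightarrow> real) \<Rightarrow> real" where
  "Dhat u w = (LINT t|leb01. (Dhat_fun u w t 1)\<^sup>2)"

definition Vhat ::
  "real measure \<Rightarrow> (real \<Rightarrow> real \<Rightarrow> real) \<Rightarrow> (real \<Rightarrow> real \<Rightarrow> real) \<Rightarrow> real" where
  "Vhat \<nu> u w =
     sqrt (LINT l|\<nu>. ((LINT t|leb01. (Dhat_fun u w t l)\<^sup>2)
                        - l\<^sup>2 * (LINT t|leb01. (Dhat_fun u w t 1)\<^sup>2))\<^sup>2)"

definition What ::
  "real measure \<Rightarrow> real \<Rightarrow> (real \<Rightarrow> real \<Rightarrow> real) \<Rightarrow> (real \<Rightarrow> real \<Rightarrow> real) \<Rightarrow> real" where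
  "What \<nu> \<Delta> u w = (Dhat u w - \<Delta>) / Vhat \<nu> u w"

text \<open>The event \<open>What > q\<close>, in the form that also covers \<open>Vhat = 0\<close>.\<close>

definition rejects ::
  "real measure \<Rightarrow> real \<Rightarrow> real \<Rightarrow> (real \<Rightarrow> real \<Rightarrow> real) \<Rightarrow> (real \<Rightarrow> real \<Rightarrow> real) \<Rightarrow> bool" where
  "rejects \<nu> \<Delta> q u w \<longleftrightarrow> Dhat u w - \<Delta> > q * Vhat \<nu> u w"

lemma rejects_iff_What:
  assumes "Vhat \<nu> u w > 0"
  shows "rejects \<nu> \<Delta> q u w \<longleftrightarrow> What \<nu> \<Delta> u w > q"
  using assms by (simp add: rejects_def What_def pos_less_divide_eq)

subsection \<open>Brownian motion and the limit law\<close>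

definition std_brownian_motion :: "'b measure \<Rightarrow> (real \<Rightarrow> 'b \<Rightarrow> real) \<Rightarrow> bool" where
  "std_brownian_motion N B \<longleftrightarrow>
     prob_space N \<and>
     (\<forall>t\<in>{0..1}. B t \<in> borel_measurable N) \<and>
     (AE \<omega> in N. B 0 \<omega> = 0) \<and>
     (\<forall>\<omega>\<in>space N. continuous_on {0..1} (\<lambda>t. B t \<omega>)) \<and>
     (\<forall>s t. 0 \<le> s \<and> s < t \<and> t \<le> 1 \<longrightarrow>
        distributed N lborel (\<lambda>\<omega>. B t \<omega> - B s \<omega>)
          (\<lambda>x. ennreal (normal_density 0 (sqrt (t - s)) x))) \<and>
     (\<forall>(n::nat) t. (\<forall>i\<le>n. t i \<in> {0..1}) \<and> (\<forall>i<n. t i \<le> t (Suc i)) \<longrightarrow>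
        prob_space.indep_vars N (\<lambda>_. borel) (\<lambda>i \<omega>. B (t (Suc i)) \<omega> - B (t i) \<omega>) {..<n})"

definition bridge_integral :: "real measure \<Rightarrow> (real \<Rightarrow> 'b \<Rightarrow> real) \<Rightarrow> 'b \<Rightarrow> real" where
  "bridge_integral \<nu> B \<omega> = (LINT l|\<nu>. l\<^sup>2 * (B l \<omega> - l * B 1 \<omega>)\<^sup>2)"

definition limit_W :: "real measure \<Rightarrow> (real \<Rightarrow> 'b \<Rightarrow> real) \<Rightarrow> 'b \<Rightarrow> real" where
  "limit_W \<nu> B \<omega> = B 1 \<omega> / sqrt (bridge_integral \<nu> B \<omega>)"

definition quantile :: "real measure \<Rightarrow> real \<Rightarrow> real" where
  "quantile \<mu> p = Inf {x. p \<le> cdf \<mu> x}"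

subsection \<open>Convergence in distribution and asymptotic properties of tests\<close>

text \<open>
  \<open>m, n \<rightarrow> \<infinity>\<close> along a filter \<open>F\<close> on the pairs of sample sizes. The unrestricted double limit is
  \<open>F = sequentially \<times>\<^sub>F sequentially\<close>; smaller filters express regimes such as a convergent ratio
  \<open>m / (m + n)\<close>.
\<close>

definition sample_sizes_to_infinity :: "(nat \<times> nat) filter \<Rightarrow> bool" where
  "sample_sizes_to_infinity F \<longleftrightarrow> filterlim fst at_top F \<and> filterlim snd at_top F"

text \<open>
  Convergence in distribution along a filter. The library's \<open>weak_conv_m\<close> covers only sequences of
  laws on the real line.
\<close>

definition converges_in_distribution ::
  "'i filter \<Rightarrow> 'a measure \<Rightarrow> ('i \<Rightarrow> 'a \<Rightarrow> 'c::topological_space) \<Rightarrow> 'b measure \<Rightarrow> ('b \<Rightarrow> 'c) \<Rightarrow> bool"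
  where
  "converges_in_distribution F M Z N Z0 \<longleftrightarrow>
     (\<forall>\<^sub>F i in F. Z i \<in> borel_measurable M) \<and>
     Z0 \<in> borel_measurable N \<and>
     (\<forall>f :: 'c \<Rightarrow> real. continuous_on UNIV f \<and> bounded (range f) \<longrightarrow>
        ((\<lambda>i. LINT \<omega>|M. f (Z i \<omega>)) \<longlongrightarrow> (LINT \<omega>|N. f (Z0 \<omega>))) F)"

text \<open>\<open>p i\<close> is the rejection probability and \<open>H0\<close>, \<open>H1\<close> say that the model satisfies the
  null hypothesis or the alternative.\<close>

definition asymptotic_level :: "'i filter \<Rightarrow> real \<Rightarrow> bool \<Rightarrow> ('i \<Rightarrow> real) \<Rightarrow> bool" where
  "asymptotic_level F \<alpha> H0 p \<longleftrightarrow> (H0 \<longrightarrow> (\<exists>l\<le>\<alpha>. (p \<longlongrightarrow> l) F))"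

definition consistent_test :: "'i filter \<Rightarrow> bool \<Rightarrow> ('i \<Rightarrow> real) \<Rightarrow> bool" where
  "consistent_test F H1 p \<longleftrightarrow> (H1 \<longrightarrow> (p \<longlongrightarrow> 1) F)"

end

theory Submission
  imports Defs
begin

text \<open>
  Write $s = \sqrt{m+n}$. The test rejects exactly when
  $s(\hat D - D) - q\, s\hat V > s(\Delta - D)$. By the continuous mapping theorem the left-hand
  side converges in distribution to $\zeta(\mathbb B(1) - q\sqrt V)$, where $V$ is
  the integral \<open>bridge_integral \<nu> B\<close> of the squared Brownian bridge with weight $\lambda^2$. If $D < \Delta$ or $D > \Delta$,
  the threshold diverges to $\infty$ or $-\infty$ while the left-hand side stays tight, so the
  rejection probability tends to 0 or 1 (\<open>converges_in_distribution_tail_diverging\<close>).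

  If $D = \Delta$, the threshold is 0 and $\zeta > 0$, so the rejection probability tends to
  $P(\mathbb B(1) > q\sqrt V) = P(\mathbb W > q)$, provided that 0 is not an atom of the limit. This
  number is exactly $\alpha$ because the law of $\mathbb W$ has no atoms. Both facts are
  instances of $P(\mathbb B(1) = q\sqrt V) = 0$ for every real $q$
  (\<open>brownian_bridge_ratio_no_atom\<close>).

  This is clear from the independence of $\mathbb B(1)$ and the bridge, but a short argument by
  quasi-invariance proves it without conditioning on the bridge. Adding
  the linear drift $h\lambda$ to $\mathbb B(\lambda)$ leaves the bridge, hence $V$, unchanged and
  moves $U = \mathbb B(1) - q\sqrt V$ to $U + h$; on the other hand it amounts to a change of
  measure with the positive density $\exp(h\mathbb B(1) - h^2/2)$. So if 0 were an atom of $U$, every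
  real number would be one, which is impossible because a law has only countably many atoms. The
  change of measure is proved for functions of finitely many increments, where it is a product of
  one-dimensional Gaussian identities, and carried over to $V$ by approximating it with Riemann sums
  along the continuous paths.
\<close>

section \<open>Shifted independent Gaussian variables\<close>

lemma normal_density_shift:
  assumes "\<sigma> \<noteq> 0"
  shows "normal_density \<mu> \<sigma> x = normal_density 0 \<sigma> x * exp (\<mu> * x / \<sigma>\<^sup>2 - \<mu>\<^sup>2 / (2 * \<sigma>\<^sup>2))"
proof -
  have "- (x - \<mu>)\<^sup>2 / (2 * \<sigma>\<^sup>2) = - (x - 0)\<^sup>2 / (2 * \<sigma>\<^sup>2) + (\<mu> * x / \<sigma>\<^sup>2 - \<mu>\<^sup>2 / (2 * \<sigma>\<^sup>2))"
    using assms by (simp add: field_simps power2_eq_square)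
  then show ?thesis
    unfolding normal_density_def by (simp only: exp_add mult.assoc)
qed

lemma (in prob_space) normal_shift_eq_tilt:
  assumes "\<sigma> > 0" and X: "distributed M lborel X (\<lambda>x. ennreal (normal_density 0 \<sigma> x))"
  shows "distr M borel (\<lambda>\<omega>. X \<omega> + \<mu>) =
    density (distr M borel X) (\<lambda>x. ennreal (exp (\<mu> * x / \<sigma>\<^sup>2 - \<mu>\<^sup>2 / (2 * \<sigma>\<^sup>2))))"
proof -
  have "distributed M lborel (\<lambda>\<omega>. \<mu> + X \<omega> * 1) (\<lambda>x. ennreal (normal_density (\<mu> + 0 * 1) (\<bar>1\<bar> * \<sigma>) x))"
    using normal_density_affine[OF X \<open>\<sigma> > 0\<close>, of 1 \<mu>] by simp
  then have "distr M lborel (\<lambda>\<omega>. X \<omega> + \<mu>) = density lborel (\<lambda>x. ennreal (normal_density \<mu> \<sigma> x))"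
    by (simp add: distributed_distr_eq_density add.commute)
  also have "\<dots> = density lborel (\<lambda>x. ennreal (normal_density 0 \<sigma> x) *
      ennreal (exp (\<mu> * x / \<sigma>\<^sup>2 - \<mu>\<^sup>2 / (2 * \<sigma>\<^sup>2))))"
    using \<open>\<sigma> > 0\<close> by (subst normal_density_shift) (auto simp: ennreal_mult)
  also have "\<dots> = density (distr M lborel X) (\<lambda>x. ennreal (exp (\<mu> * x / \<sigma>\<^sup>2 - \<mu>\<^sup>2 / (2 * \<sigma>\<^sup>2))))"
    by (subst density_density_eq[symmetric]) (auto simp: distributed_distr_eq_density[OF X])
  finally show ?thesis
    by (simp cong: distr_cong)
qed

text \<open>
  A change of measure that realises a shift in each coordinate realises the joint shift, by
  independence: both laws agree on rectangles, where the integrals factorise. The laws are taken on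
  the product space so that any function of all the variables can be applied afterwards.
\<close>

lemma (in prob_space) indep_vars_shift_eq_tilt:
  fixes X :: "'i \<Rightarrow> 'a \<Rightarrow> real" and r :: "real \<Rightarrow> ennreal"
  assumes "finite I" and indep: "indep_vars (\<lambda>_. borel) X I"
    and r[measurable]: "r \<in> borel_measurable borel"
    and tilt: "\<And>i. i \<in> I \<Longrightarrow> distr M borel (\<lambda>\<omega>. X i \<omega> + c) = density (distr M borel (X i)) r"
  shows "distr (density M (\<lambda>\<omega>. \<Prod>i\<in>I. r (X i \<omega>))) (Pi\<^sub>M I (\<lambda>_. borel)) (\<lambda>\<omega>. \<lambda>i\<in>I. X i \<omega>) =
    distr M (Pi\<^sub>M I (\<lambda>_. borel)) (\<lambda>\<omega>. \<lambda>i\<in>I. X i \<omega> + c)" (is "?P = ?Q")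
proof -
  have X[measurable]: "i \<in> I \<Longrightarrow> X i \<in> borel_measurable M" for i
    using indep by (auto simp: indep_vars_def)
  have rect: "emeasure ?P (Pi\<^sub>E I A) = emeasure ?Q (Pi\<^sub>E I A)"
    if "\<And>i. i \<in> I \<Longrightarrow> A i \<in> sets borel" for A
  proof -
    have A[measurable]: "i \<in> I \<Longrightarrow> A i \<in> sets borel" for i by (rule that)
    have [measurable]: "Pi\<^sub>E I A \<in> sets (Pi\<^sub>M I (\<lambda>_. borel))"
      using \<open>finite I\<close> by (intro sets_PiM_I_finite) auto
    have ind: "indicator (Pi\<^sub>E I A) (\<lambda>i\<in>I. Z i) = (\<Prod>i\<in>I. indicator (A i) (Z i) :: ennreal)" for Z :: "'i \<Rightarrow> real"
      using \<open>finite I\<close> by (auto simp: indicator_def PiE_iff prod_zero_iff)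
    have "emeasure ?P (Pi\<^sub>E I A) = (\<integral>\<^sup>+\<omega>. indicator (Pi\<^sub>E I A) \<omega> \<partial>?P)"
      by simp
    also have "\<dots> = (\<integral>\<^sup>+\<omega>. (\<Prod>i\<in>I. r (X i \<omega>)) * indicator (Pi\<^sub>E I A) (\<lambda>i\<in>I. X i \<omega>) \<partial>M)"
      by (subst nn_integral_distr) (auto simp: nn_integral_density)
    also have "\<dots> = (\<integral>\<^sup>+\<omega>. (\<Prod>i\<in>I. r (X i \<omega>) * indicator (A i) (X i \<omega>)) \<partial>M)"
      by (simp only: ind prod.distrib)
    also have "\<dots> = (\<Prod>i\<in>I. \<integral>\<^sup>+\<omega>. r (X i \<omega>) * indicator (A i) (X i \<omega>) \<partial>M)"
      using \<open>finite I\<close> 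
      by (intro indep_vars_nn_integral indep_vars_compose2[OF indep, of "\<lambda>i x. r x * indicator (A i) x"]) auto
    also have "\<dots> = (\<Prod>i\<in>I. \<integral>\<^sup>+\<omega>. indicator (A i) (X i \<omega> + c) \<partial>M)"
    proof (rule prod.cong)
      fix i assume i[measurable]: "i \<in> I"
      have "(\<integral>\<^sup>+\<omega>. r (X i \<omega>) * indicator (A i) (X i \<omega>) \<partial>M) =
          (\<integral>\<^sup>+x. indicator (A i) x \<partial>density (distr M borel (X i)) r)"
        by (simp add: nn_integral_density nn_integral_distr del: nn_integral_indicator)
      also have "\<dots> = (\<integral>\<^sup>+\<omega>. indicator (A i) (X i \<omega> + c) \<partial>M)"
        by (subst tilt[symmetric]) (simp_all add: nn_integral_distr i del: nn_integral_indicator)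
      finally show "(\<integral>\<^sup>+\<omega>. r (X i \<omega>) * indicator (A i) (X i \<omega>) \<partial>M) = \<dots>" .
    qed simp
    also have "\<dots> = (\<integral>\<^sup>+\<omega>. (\<Prod>i\<in>I. indicator (A i) (X i \<omega> + c)) \<partial>M)"
      using \<open>finite I\<close>
      by (intro indep_vars_nn_integral[symmetric] indep_vars_compose2[OF indep, of "\<lambda>i x. indicator (A i) (x + c)"]) auto
    also have "\<dots> = (\<integral>\<^sup>+\<omega>. indicator (Pi\<^sub>E I A) (\<lambda>i\<in>I. X i \<omega> + c) \<partial>M)"
      by (simp only: ind)
    also have "\<dots> = (\<integral>\<^sup>+\<omega>. indicator (Pi\<^sub>E I A) \<omega> \<partial>?Q)"
      by (subst nn_integral_distr) auto
    finally show ?thesis by simp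
  qed
  interpret Q: prob_space ?Q by (rule prob_space_distr) simp
  show ?thesis
  proof (rule measure_eqI_PiM_finite[where A="\<lambda>_::nat. Pi\<^sub>E I (\<lambda>_. UNIV)"])
    show "emeasure ?P (Pi\<^sub>E I (\<lambda>_. UNIV)) \<noteq> \<infinity>"
      by (subst rect) auto
    show "range (\<lambda>_::nat. Pi\<^sub>E I (\<lambda>_. UNIV)) \<subseteq> prod_algebra I (\<lambda>_. borel :: real measure)"
      using \<open>finite I\<close> by (auto simp: prod_algebra_eq_finite)
  qed (use \<open>finite I\<close> rect in \<open>auto simp: space_PiM\<close>)
qed

section \<open>Riemann sums for a probability measure on the half-open unit interval\<close>

text \<open>
  Rounding up to the next grid point keeps the argument in $[0,1]$ and moves it by at most $1/n$, so
  dominated convergence applies whatever the measure is. It may have atoms, so the cells must not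
  overlap; they are therefore given by the value of the ceiling function.
\<close>

lemma right_endpoint_sums_converge:
  fixes f :: "real \<Rightarrow> real"
  assumes \<nu>: "prob_space \<nu>" "sets \<nu> = sets (restrict_space borel {0<..1})"
    and f: "continuous_on {0..1} f"
  shows "(\<lambda>n. \<Sum>k = 1..n. measure \<nu> {l \<in> space \<nu>. \<lceil>real n * l\<rceil> = int k} * f (real k / real n))
    \<longlonglongrightarrow> (LINT l|\<nu>. f l)"
proof -
  interpret \<nu>: prob_space \<nu> by fact
  have space: "space \<nu> = {0<..1}"
    using sets_eq_imp_space_eq[OF \<nu>(2)] by (simp add: space_restrict_space)
  have meas: "g \<in> borel_measurable \<nu>" if "g \<in> borel_measurable (restrict_space borel {0<..1})" for g :: "real \<Rightarrow> real"
    using that measurable_cong_sets[OF \<nu>(2) refl, of borel] by blast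
  have [measurable]: "(\<lambda>l. l) \<in> borel_measurable \<nu>"
    by (rule meas, rule measurable_restrict_space1, simp)
  have fm[measurable]: "f \<in> borel_measurable \<nu>"
    by (rule meas, rule borel_measurable_continuous_on_restrict, rule continuous_on_subset[OF f], auto)
  obtain C where C: "\<bar>f x\<bar> \<le> C" if "x \<in> {0..1}" for x
  proof -
    have "bounded (f ` {0..1})"
      using compact_imp_bounded[OF compact_continuous_image[OF f compact_Icc]] .
    then show ?thesis
      using that unfolding bounded_iff by (metis image_eqI real_norm_def)
  qed
  define A where "A n k = {l \<in> space \<nu>. \<lceil>real n * l\<rceil> = int k}" for n k
  have A[measurable]: "A n k \<in> sets \<nu>" for n k
    unfolding A_def by measurable
  \<comment> \<open>\<open>g n\<close> is \<open>f\<close> evaluated at its argument rounded up to the grid of mesh \<open>1 / n\<close>, written as a step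
    function whose integral is the \<open>n\<close>-th sum.\<close>
  define g where "g n l = (\<Sum>k = 1..n. indicator (A n k) l * f (real k / real n))" for n l
  have gm: "g n \<in> borel_measurable \<nu>" for n
    unfolding g_def by measurable
  have cell: "\<exists>k\<in>{1..n}. \<lceil>real n * l\<rceil> = int k" if "l \<in> space \<nu>" "n > 0" for n l
  proof -
    have l: "0 < l" "l \<le> 1" using that(1) by (auto simp: space)
    have "0 < real n * l" using l that(2) by simp
    then have pos: "0 < \<lceil>real n * l\<rceil>" by (simp only: zero_less_ceiling)
    have "\<lceil>real n * l\<rceil> \<le> int n"
      using l by (simp add: ceiling_le_iff mult_left_le)
    moreover obtain k where "\<lceil>real n * l\<rceil> = int k"
      using pos zero_le_imp_eq_int[of "\<lceil>real n * l\<rceil>"] by auto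
    ultimately show ?thesis using pos by (intro bexI[of _ k]) auto
  qed
  have g_eq: "g n l = f (real k / real n)" if "l \<in> space \<nu>" "k \<in> {1..n}" "\<lceil>real n * l\<rceil> = int k" for n l k
  proof -
    have "g n l = (\<Sum>i = 1..n. if i = k then f (real k / real n) else 0)"
      unfolding g_def A_def using that by (intro sum.cong) (auto simp: indicator_def)
    also have "\<dots> = f (real k / real n)" using that by (subst sum.delta) auto
    finally show ?thesis .
  qed
  have "(\<lambda>n. LINT l|\<nu>. g n l) \<longlonglongrightarrow> (LINT l|\<nu>. f l)"
  proof (rule integral_dominated_convergence[where w="\<lambda>_. C"])
    show "AE l in \<nu>. norm (g n l) \<le> C" for n
    proof (rule AE_I2)
      fix l assume l: "l \<in> space \<nu>"
      show "norm (g n l) \<le> C"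
      proof (cases "n = 0")
        case True
        then show ?thesis using C[of 0] by (simp add: g_def)
      next
        case False
        then obtain k where k: "k \<in> {1..n}" "\<lceil>real n * l\<rceil> = int k" using cell[OF l] by blast
        then show ?thesis using g_eq[OF l k] C[of "real k / real n"] by simp
      qed
    qed
    show "AE l in \<nu>. (\<lambda>n. g n l) \<longlonglongrightarrow> f l"
    proof (rule AE_I2)
      fix l assume l: "l \<in> space \<nu>"
      then have l01: "l \<in> {0..1}" by (simp add: space)
      let ?p = "\<lambda>n. real_of_int \<lceil>real n * l\<rceil> / real n"
      have p: "g n l = f (?p n) \<and> ?p n \<in> {0..1} \<and> l \<le> ?p n \<and> ?p n \<le> l + 1 / real n" if "n > 0" for n
      proof -
        obtain k where k: "k \<in> {1..n}" "\<lceil>real n * l\<rceil> = int k" using cell[OF l \<open>n > 0\<close>] by blast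
        then have "real n * l \<le> real k" "real k < real n * l + 1" by linarith+
        then show ?thesis using g_eq[OF l k] k \<open>n > 0\<close> by (simp add: field_simps)
      qed
      have "?p \<longlonglongrightarrow> l"
      proof (rule tendsto_sandwich[where f="\<lambda>_. l" and h="\<lambda>n. l + 1 / real n"])
        show "(\<lambda>n. l + 1 / real n) \<longlonglongrightarrow> l"
          using tendsto_add[OF tendsto_const lim_1_over_n, of l] by simp
      qed (use p in \<open>auto intro!: eventually_mono[OF eventually_gt_at_top[of 0]]\<close>)
      moreover have "\<forall>\<^sub>F n in sequentially. ?p n \<in> {0..1}"
        using p by (auto intro!: eventually_mono[OF eventually_gt_at_top[of 0]])
      ultimately have "(\<lambda>n. f (?p n)) \<longlonglongrightarrow> f l"
        using continuous_on_tendsto_compose[OF f _ l01] by blast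
      then show "(\<lambda>n. g n l) \<longlonglongrightarrow> f l"
        by (rule Lim_transform_eventually) (use p in \<open>auto intro!: eventually_mono[OF eventually_gt_at_top[of 0]]\<close>)
    qed
  qed (rule fm gm integrable_const \<nu>.integrable_const)+
  moreover have "(LINT l|\<nu>. g n l) = (\<Sum>k = 1..n. measure \<nu> (A n k) * f (real k / real n))" for n
    unfolding g_def by (subst Bochner_Integration.integral_sum) (auto intro!: integrable_mult_left simp: \<nu>.emeasure_eq_measure)
  ultimately show ?thesis by (simp add: A_def)
qed

section \<open>Brownian motion with a linear drift\<close>

text \<open>
  The Cameron-Martin formula for the drift $h\lambda$, for a statistic that depends on the path
  through its values on a grid only. The drift adds $h/n$ to each of the $n$ independent
  $N(0, 1/n)$ increments, whose tilts multiply to $\exp(h\mathbb B(1) - h^2/2)$. It adds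
  $h$ to $\mathbb B(1)$ and nothing to the bridge, so \<open>T\<close> turns into \<open>T + h\<close>. In this way a
  shift of the single variable \<open>T\<close> is expressed by a density that is the same for all grids, which
  is what allows the mesh to tend to zero.
\<close>

lemma brownian_linear_shift_eq_tilt:
  fixes n :: nat and h q :: real and w :: "nat \<Rightarrow> real"
  assumes bm: "std_brownian_motion N B" and "n > 0"
  defines "T \<equiv> \<lambda>\<omega>. B 1 \<omega> - q * sqrt (\<Sum>k = 1..n. w k * (B (real k / real n) \<omega> - real k / real n * B 1 \<omega>)\<^sup>2)"
  shows "distr (density N (\<lambda>\<omega>. ennreal (exp (h * B 1 \<omega> - h\<^sup>2 / 2)))) borel T = distr N borel (\<lambda>\<omega>. T \<omega> + h)"
proof -
  interpret N: prob_space N using bm by (simp add: std_brownian_motion_def)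
  define t where "t i = real i / real n" for i
  have t01: "t i \<in> {0..1}" if "i \<le> n" for i
    using that \<open>n > 0\<close> by (auto simp: t_def divide_le_eq)
  have B[measurable]: "s \<in> {0..1} \<Longrightarrow> B s \<in> borel_measurable N" for s
    using bm by (auto simp: std_brownian_motion_def)
  have [measurable]: "B 1 \<in> borel_measurable N" by (rule B) simp
  have Bt[measurable]: "B (t i) \<in> borel_measurable N" if "i \<le> n" for i
    using t01[OF that] by (rule B)
  define \<xi> where "\<xi> i \<omega> = B (t (Suc i)) \<omega> - B (t i) \<omega>" for i \<omega>
  have \<xi>[measurable]: "\<xi> i \<in> borel_measurable N" if "i \<in> {..<n}" for i
    unfolding \<xi>_def using Bt[of i] Bt[of "Suc i"] that by (intro borel_measurable_diff) auto
  have indep: "N.indep_vars (\<lambda>_. borel) \<xi> {..<n}"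
  proof -
    have "(\<forall>i\<le>n. t i \<in> {0..1}) \<and> (\<forall>i<n. t i \<le> t (Suc i))"
      using t01 by (auto simp: t_def divide_right_mono)
    then show ?thesis
      using bm unfolding std_brownian_motion_def \<xi>_def by blast
  qed
  define r where "r x = ennreal (exp (h * x - h\<^sup>2 / (2 * real n)))" for x
  have tilt: "distr N borel (\<lambda>\<omega>. \<xi> i \<omega> + h / n) = density (distr N borel (\<xi> i)) r" if "i \<in> {..<n}" for i
  proof -
    have "0 \<le> t i \<and> t i < t (Suc i) \<and> t (Suc i) \<le> 1"
      using that \<open>n > 0\<close> by (auto simp: t_def divide_le_eq divide_strict_right_mono)
    then have "distributed N lborel (\<xi> i) (\<lambda>x. ennreal (normal_density 0 (sqrt (t (Suc i) - t i)) x))"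
      using bm unfolding std_brownian_motion_def \<xi>_def by blast
    moreover have "t (Suc i) - t i = 1 / n"
      by (simp add: t_def diff_divide_distrib[symmetric])
    ultimately have d: "distributed N lborel (\<xi> i) (\<lambda>x. ennreal (normal_density 0 (sqrt (1 / n)) x))"
      by simp
    have "h / n * x / (sqrt (1 / n))\<^sup>2 - (h / n)\<^sup>2 / (2 * (sqrt (1 / n))\<^sup>2) = h * x - h\<^sup>2 / (2 * real n)" for x
      using \<open>n > 0\<close> by (simp add: field_simps power2_eq_square)
    then have r_eq: "r = (\<lambda>x. ennreal (exp (h / n * x / (sqrt (1 / n))\<^sup>2 - (h / n)\<^sup>2 / (2 * (sqrt (1 / n))\<^sup>2))))"
      unfolding r_def by (simp only:)
    show ?thesis
      unfolding r_eq by (rule N.normal_shift_eq_tilt[OF _ d]) (use \<open>n > 0\<close> in simp)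
  qed
  have r[measurable]: "r \<in> borel_measurable borel" unfolding r_def by measurable
  let ?P = "Pi\<^sub>M {..<n} (\<lambda>_. borel :: real measure)"
  define R where "R \<omega> = (\<Prod>i<n. r (\<xi> i \<omega>))" for \<omega>
  have shift: "distr (density N R) ?P (\<lambda>\<omega>. \<lambda>i\<in>{..<n}. \<xi> i \<omega>) = distr N ?P (\<lambda>\<omega>. \<lambda>i\<in>{..<n}. \<xi> i \<omega> + h / n)"
    unfolding R_def using N.indep_vars_shift_eq_tilt[OF _ indep r tilt] by simp

  \<comment> \<open>\<open>T\<close> as a function of the increments. It agrees with \<open>T\<close> only almost surely, because the partial
    sums of the increments give \<open>B (k / n) - B 0\<close>.\<close>
  define \<Phi> where "\<Phi> x = (\<Sum>i<n. x i) -
      q * sqrt (\<Sum>k = 1..n. w k * ((\<Sum>i<k. x i) - real k / real n * (\<Sum>i<n. x i))\<^sup>2)" for x :: "nat \<Rightarrow> real"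
  have [measurable]: "(\<lambda>x. \<Sum>i<k. x i) \<in> borel_measurable ?P" if "k \<le> n" for k
    using that by (intro borel_measurable_sum measurable_component_singleton) auto
  have \<Phi>[measurable]: "\<Phi> \<in> borel_measurable ?P"
    unfolding \<Phi>_def by measurable
  have \<Phi>_shift: "\<Phi> (\<lambda>i\<in>{..<n}. x i + h / n) = \<Phi> (\<lambda>i\<in>{..<n}. x i) + h" for x
  proof -
    have sums: "(\<Sum>i<k. (\<lambda>i\<in>{..<n}. x i + h / n) i) = (\<Sum>i<k. (\<lambda>i\<in>{..<n}. x i) i) + real k / real n * h"
      if "k \<le> n" for k
    proof -
      have "(\<Sum>i<k. (\<lambda>i\<in>{..<n}. x i + h / n) i) = (\<Sum>i<k. (\<lambda>i\<in>{..<n}. x i) i + h / n)"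
        using that by (intro sum.cong) auto
      then show ?thesis by (simp add: sum.distrib)
    qed
    have dev: "(\<Sum>i<k. (\<lambda>i\<in>{..<n}. x i + h / n) i) - real k / real n * (\<Sum>i<n. (\<lambda>i\<in>{..<n}. x i + h / n) i) =
        (\<Sum>i<k. (\<lambda>i\<in>{..<n}. x i) i) - real k / real n * (\<Sum>i<n. (\<lambda>i\<in>{..<n}. x i) i)" if "k \<le> n" for k
      unfolding sums[OF that] sums[OF order_refl] using \<open>n > 0\<close> by (simp add: distrib_left)
    have "(\<Sum>k = 1..n. w k * ((\<Sum>i<k. (\<lambda>i\<in>{..<n}. x i + h / n) i) - real k / real n * (\<Sum>i<n. (\<lambda>i\<in>{..<n}. x i + h / n) i))\<^sup>2) =
      (\<Sum>k = 1..n. w k * ((\<Sum>i<k. (\<lambda>i\<in>{..<n}. x i) i) - real k / real n * (\<Sum>i<n. (\<lambda>i\<in>{..<n}. x i) i))\<^sup>2)"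
      by (intro sum.cong refl, subst dev) auto
    then show ?thesis
      unfolding \<Phi>_def using sums[of n] \<open>n > 0\<close> by simp
  qed
  have partial: "(\<Sum>i<k. (\<lambda>i\<in>{..<n}. \<xi> i \<omega>) i) = B (real k / real n) \<omega> - B 0 \<omega>" if "k \<le> n" for k \<omega>
  proof -
    have "(\<Sum>i<k. (\<lambda>i\<in>{..<n}. \<xi> i \<omega>) i) = (\<Sum>i<k. \<xi> i \<omega>)"
      using that by (intro sum.cong) auto
    also have "\<dots> = B (t k) \<omega> - B (t 0) \<omega>"
      unfolding \<xi>_def by (rule sum_lessThan_telescope)
    finally show ?thesis by (simp add: t_def)
  qed
  have AE0: "AE \<omega> in N. B 0 \<omega> = 0" using bm by (simp add: std_brownian_motion_def)
  have T_AE: "AE \<omega> in N. T \<omega> = \<Phi> (\<lambda>i\<in>{..<n}. \<xi> i \<omega>)"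
    using AE0
  proof eventually_elim
    case (elim \<omega>)
    have total: "(\<Sum>i<n. (\<lambda>i\<in>{..<n}. \<xi> i \<omega>) i) = B 1 \<omega>"
      unfolding partial[OF order_refl] using elim \<open>n > 0\<close> by simp
    have "(\<Sum>k = 1..n. w k * (B (real k / real n) \<omega> - real k / real n * B 1 \<omega>)\<^sup>2) =
      (\<Sum>k = 1..n. w k * ((\<Sum>i<k. (\<lambda>i\<in>{..<n}. \<xi> i \<omega>) i) - real k / real n * B 1 \<omega>)\<^sup>2)"
      by (intro sum.cong refl, subst partial) (auto simp: elim)
    then show ?case
      unfolding T_def \<Phi>_def total by simp
  qed
  have R_AE: "AE \<omega> in N. ennreal (exp (h * B 1 \<omega> - h\<^sup>2 / 2)) = R \<omega>"
    using AE0
  proof eventually_elim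
    case (elim \<omega>)
    have "(\<Sum>i<n. \<xi> i \<omega>) = B 1 \<omega>"
      using partial[of n \<omega>] elim \<open>n > 0\<close> by simp
    then have "(\<Sum>i<n. h * \<xi> i \<omega> - h\<^sup>2 / (2 * real n)) = h * B 1 \<omega> - h\<^sup>2 / 2"
      using \<open>n > 0\<close> by (simp add: sum_subtractf sum_distrib_left[symmetric])
    then show ?case
      unfolding R_def r_def by (simp add: prod_ennreal exp_sum[symmetric])
  qed
  have [measurable]: "T \<in> borel_measurable N"
    unfolding T_def t_def[symmetric] by measurable
  have [measurable]: "R \<in> borel_measurable N"
    unfolding R_def by measurable
  have "distr (density N (\<lambda>\<omega>. ennreal (exp (h * B 1 \<omega> - h\<^sup>2 / 2)))) borel T = distr (density N R) borel T"
    using R_AE by (subst density_cong) auto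
  also have "\<dots> = distr (density N R) borel (\<lambda>\<omega>. \<Phi> (\<lambda>i\<in>{..<n}. \<xi> i \<omega>))"
    using T_AE by (intro distr_cong_AE refl) (auto simp: AE_density)
  also have "\<dots> = distr (distr (density N R) ?P (\<lambda>\<omega>. \<lambda>i\<in>{..<n}. \<xi> i \<omega>)) borel \<Phi>"
    by (subst distr_distr) (auto simp: comp_def)
  also have "\<dots> = distr N borel (\<lambda>\<omega>. \<Phi> (\<lambda>i\<in>{..<n}. \<xi> i \<omega> + h / n))"
    unfolding shift by (subst distr_distr) (auto simp: comp_def)
  also have "\<dots> = distr N borel (\<lambda>\<omega>. T \<omega> + h)"
    unfolding \<Phi>_shift using T_AE by (intro distr_cong_AE refl) auto
  finally show ?thesis .
qed

text \<open>
  Let $U = \mathbb B(1) - q\sqrt V$. The shift formula for the discretised statistics passes to the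
  limit in the characteristic functions: tilting by $\exp(h\mathbb B(1) - h^2/2)$ turns the law of
  $U$ into that of $U + h$. As the density is positive, an atom of $U$ at 0 entails an atom at
  $-h$, for every real $h$.
\<close>

lemma brownian_bridge_ratio_no_atom:
  assumes bm: "std_brownian_motion N B"
    and \<nu>: "prob_space \<nu>" "sets \<nu> = sets (restrict_space borel {0<..1})"
    and V[measurable]: "bridge_integral \<nu> B \<in> borel_measurable N"
  shows "measure N {\<omega> \<in> space N. B 1 \<omega> = q * sqrt (bridge_integral \<nu> B \<omega>)} = 0"
proof -
  interpret N: prob_space N using bm by (simp add: std_brownian_motion_def)
  have B[measurable]: "s \<in> {0..1} \<Longrightarrow> B s \<in> borel_measurable N" for s
    using bm by (auto simp: std_brownian_motion_def)
  have [measurable]: "B 1 \<in> borel_measurable N" by (rule B) simp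
  define U where "U \<omega> = B 1 \<omega> - q * sqrt (bridge_integral \<nu> B \<omega>)" for \<omega>
  have U[measurable]: "U \<in> borel_measurable N" unfolding U_def by measurable
  define w where "w n k = measure \<nu> {l \<in> space \<nu>. \<lceil>real n * l\<rceil> = int k} * (real k / real n)\<^sup>2" for n k
  define T where "T n \<omega> = B 1 \<omega> - q * sqrt (\<Sum>k = 1..n. w n k * (B (real k / real n) \<omega> - real k / real n * B 1 \<omega>)\<^sup>2)" for n \<omega>
  have T[measurable]: "T n \<in> borel_measurable N" for n
    unfolding T_def
    by (intro borel_measurable_diff borel_measurable_times borel_measurable_const borel_measurable_sqrt
        borel_measurable_sum borel_measurable_power B) (auto simp: divide_le_eq)
  have T_lim: "(\<lambda>n. T (Suc n) \<omega>) \<longlonglongrightarrow> U \<omega>" if "\<omega> \<in> space N" for \<omega>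
  proof -
    have "continuous_on {0..1} (\<lambda>t. B t \<omega>)"
      using bm that by (simp add: std_brownian_motion_def)
    then have "continuous_on {0..1} (\<lambda>l. l\<^sup>2 * (B l \<omega> - l * B 1 \<omega>)\<^sup>2)"
      by (intro continuous_intros)
    from right_endpoint_sums_converge[OF \<nu> this]
    have "(\<lambda>n. T n \<omega>) \<longlonglongrightarrow> U \<omega>"
      unfolding T_def U_def bridge_integral_def w_def mult.assoc[symmetric] by (intro tendsto_intros)
    then show ?thesis by (rule LIMSEQ_Suc)
  qed
  let ?N' = "\<lambda>h. density N (\<lambda>\<omega>. ennreal (exp (h * B 1 \<omega> - h\<^sup>2 / 2)))"
  have shift_T: "distr (?N' h) borel (T (Suc n)) = distr N borel (\<lambda>\<omega>. T (Suc n) \<omega> + h)" for h n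
    unfolding T_def by (rule brownian_linear_shift_eq_tilt[OF bm]) simp
  \<comment> \<open>The total mass of the tilted measure can be read off from the shift formula on any grid.\<close>
  have prob: "prob_space (?N' h)" for h
  proof
    have "emeasure (distr (?N' h) borel (T (Suc 0))) UNIV = emeasure (distr N borel (\<lambda>\<omega>. T (Suc 0) \<omega> + h)) UNIV"
      by (simp only: shift_T)
    then show "emeasure (?N' h) (space (?N' h)) = 1"
      by (simp add: emeasure_distr N.emeasure_space_1)
  qed
  have shift_U: "distr (?N' h) borel U = distr N borel (\<lambda>\<omega>. U \<omega> + h)" for h
  proof (rule Levy_uniqueness)
    interpret N': prob_space "?N' h" by (rule prob)
    show "real_distribution (distr (?N' h) borel U)"
      by (rule N'.real_distribution_distr) simp
    show "real_distribution (distr N borel (\<lambda>\<omega>. U \<omega> + h))"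
      by (rule N.real_distribution_distr) simp
    show "char (distr (?N' h) borel U) = char (distr N borel (\<lambda>\<omega>. U \<omega> + h))"
    proof
      fix t
      have "(\<lambda>n. CLINT \<omega>|?N' h. iexp (t * T (Suc n) \<omega>)) \<longlonglongrightarrow> (CLINT \<omega>|?N' h. iexp (t * U \<omega>))"
        by (rule integral_dominated_convergence[where w="\<lambda>_. 1"])
          (auto intro!: AE_I2 tendsto_intros T_lim)
      then have "(\<lambda>n. char (distr (?N' h) borel (T (Suc n))) t) \<longlonglongrightarrow> char (distr (?N' h) borel U) t"
        by (simp add: char_def integral_distr)
      moreover have "(\<lambda>n. CLINT \<omega>|N. iexp (t * (T (Suc n) \<omega> + h))) \<longlonglongrightarrow> (CLINT \<omega>|N. iexp (t * (U \<omega> + h)))"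
        by (rule integral_dominated_convergence[where w="\<lambda>_. 1"])
          (auto intro!: AE_I2 tendsto_intros T_lim)
      then have "(\<lambda>n. char (distr N borel (\<lambda>\<omega>. T (Suc n) \<omega> + h)) t) \<longlonglongrightarrow> char (distr N borel (\<lambda>\<omega>. U \<omega> + h)) t"
        by (simp add: char_def integral_distr)
      ultimately show "char (distr (?N' h) borel U) t = char (distr N borel (\<lambda>\<omega>. U \<omega> + h)) t"
        unfolding shift_T by (rule LIMSEQ_unique)
    qed
  qed
  define E where "E = {\<omega> \<in> space N. U \<omega> = 0}"
  have E[measurable]: "E \<in> sets N" unfolding E_def by measurable
  interpret D: real_distribution "distr N borel U" by (rule N.real_distribution_distr) simp
  have "measure N E = 0"
  proof (rule ccontr)
    assume "measure N E \<noteq> 0"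
    have "measure (distr N borel U) {x} > 0" for x
    proof -
      interpret N': prob_space "?N' (- x)" by (rule prob)
      have "measure (?N' (- x)) E \<noteq> 0"
      proof
        assume "measure (?N' (- x)) E = 0"
        then have "E \<in> null_sets (?N' (- x))"
          unfolding null_sets_def using N'.emeasure_eq_measure[of E] by auto
        then have "AE \<omega> in N. \<omega> \<notin> E"
          by (subst (asm) null_sets_density_iff) auto
        then have "E \<in> null_sets N"
          by (simp add: AE_iff_null_sets[OF E])
        with \<open>measure N E \<noteq> 0\<close> show False by (simp add: measure_eq_0_null_sets)
      qed
      also have "measure (?N' (- x)) E = measure (distr (?N' (- x)) borel U) {0}"
        by (subst measure_distr) (auto simp: E_def intro!: arg_cong2[where f=measure])
      also have "\<dots> = measure (distr N borel U) {x}"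
        unfolding shift_U by (simp add: measure_distr vimage_def)
      finally show ?thesis by (simp add: zero_less_measure_iff)
    qed
    then have "countable (UNIV :: real set)"
      using D.countable_atoms by simp
    then show False using uncountable_UNIV_real by simp
  qed
  moreover have "E = {\<omega> \<in> space N. B 1 \<omega> = q * sqrt (bridge_integral \<nu> B \<omega>)}"
    by (auto simp: E_def U_def)
  ultimately show ?thesis by simp
qed

section \<open>Tail probabilities under convergence in distribution\<close>

lemma converges_in_distribution_continuous_map:
  assumes conv: "converges_in_distribution F M Z N Z0" and g: "continuous_on UNIV g"
  shows "converges_in_distribution F M (\<lambda>i \<omega>. g (Z i \<omega>)) N (\<lambda>\<omega>. g (Z0 \<omega>))"
proof -
  have [measurable]: "g \<in> borel_measurable borel"
    using g by (rule borel_measurable_continuous_onI)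
  have fg: "continuous_on UNIV (\<lambda>x. f (g x)) \<and> bounded (range (\<lambda>x. f (g x)))"
    if "continuous_on UNIV f \<and> bounded (range f)" for f :: "_ \<Rightarrow> real"
    using that continuous_on_compose2[of UNIV f UNIV g] g
    by (auto intro: bounded_subset[of "range f"])
  show ?thesis
    using conv fg unfolding converges_in_distribution_def by (auto elim!: eventually_mono)
qed

text \<open>
  The half of the portmanteau theorem that concerns half-lines, in a form that holds along an
  arbitrary filter: the indicator of a half-line lies between clipped linear functions that
  decrease to the indicator of \<open>{c..}\<close> or increase to that of \<open>{c<..}\<close>.
\<close>

lemma converges_in_distribution_tail_bounds:
  fixes Z0 :: "'b \<Rightarrow> real"
  assumes "prob_space M" "prob_space N" and conv: "converges_in_distribution F M Z N Z0" and "e > 0"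
  shows "\<forall>\<^sub>F i in F. measure M {\<omega> \<in> space M. Z i \<omega> > c} < measure N {\<omega> \<in> space N. Z0 \<omega> \<ge> c} + e" (is ?upper)
    and "\<forall>\<^sub>F i in F. measure M {\<omega> \<in> space M. Z i \<omega> > c} > measure N {\<omega> \<in> space N. Z0 \<omega> > c} - e" (is ?lower)
proof -
  interpret M: prob_space M by fact
  interpret N: prob_space N by fact
  have Z: "\<forall>\<^sub>F i in F. Z i \<in> borel_measurable M" and Z0[measurable]: "Z0 \<in> borel_measurable N"
    using conv by (auto simp: converges_in_distribution_def)
  \<comment> \<open>A ramp of slope \<open>k\<close> through the value \<open>a\<close> at \<open>c\<close>: above the indicator of \<open>{c<..}\<close> for \<open>a = 1\<close>, below it for
    \<open>a = 0\<close>.\<close>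
  define \<phi> where "\<phi> a k x = min 1 (max 0 (a + real k * (x - c)))" for a k x
  have \<phi>_cont: "continuous_on UNIV (\<phi> a k)" for a k
    unfolding \<phi>_def by (intro continuous_intros)
  then have \<phi>_meas[measurable]: "\<phi> a k \<in> borel_measurable borel" for a k
    by (rule borel_measurable_continuous_onI)
  have \<phi>_bounds: "0 \<le> \<phi> a k x" "\<phi> a k x \<le> 1" for a k x
    by (auto simp: \<phi>_def)
  have \<phi>_bounded: "bounded (range (\<phi> a k))" for a k
    by (rule boundedI[of _ 1]) (use \<phi>_bounds in \<open>auto simp: abs_le_iff intro: order_trans[of _ 0]\<close>)
  have lim: "((\<lambda>i. LINT \<omega>|M. \<phi> a k (Z i \<omega>)) \<longlongrightarrow> (LINT \<omega>|N. \<phi> a k (Z0 \<omega>))) F" for a k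
    using conv \<phi>_cont \<phi>_bounded by (auto simp: converges_in_distribution_def)
  have int: "integrable K (\<lambda>\<omega>. \<phi> a k (Y \<omega>))" if "prob_space K" "Y \<in> borel_measurable K" for K and Y :: "_ \<Rightarrow> real" and a k
  proof -
    interpret K: prob_space K by fact
    note that(2)[measurable]
    show ?thesis by (rule K.integrable_const_bound[of _ 1]) (use \<phi>_bounds in auto)
  qed
  have pt: "(\<lambda>k. \<phi> a k x) \<longlonglongrightarrow> (if x > c then 1 else if x = c then min 1 (max 0 a) else 0)" for a x
  proof -
    consider "x > c" | "x = c" | "x < c" by linarith
    then show ?thesis
    proof cases
      case 1
      have "filterlim (\<lambda>k. a + real k * (x - c)) at_top sequentially"
        using 1 by (intro filterlim_tendsto_add_at_top[OF tendsto_const] filterlim_at_top_mult_tendsto_pos[OF tendsto_const] filterlim_real_sequentially) auto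
      then have "\<forall>\<^sub>F k in sequentially. 1 \<le> a + real k * (x - c)"
        unfolding filterlim_at_top by blast
      then have "\<forall>\<^sub>F k in sequentially. \<phi> a k x = 1"
        by eventually_elim (simp add: \<phi>_def)
      then show ?thesis using 1 by (auto intro: tendsto_eventually)
    next
      case 2
      then show ?thesis by (simp add: \<phi>_def)
    next
      case 3
      have "filterlim (\<lambda>k. - a + real k * (c - x)) at_top sequentially"
        using 3 by (intro filterlim_tendsto_add_at_top[OF tendsto_const] filterlim_at_top_mult_tendsto_pos[OF tendsto_const] filterlim_real_sequentially) auto
      then have "\<forall>\<^sub>F k in sequentially. 0 \<le> - a + real k * (c - x)"
        unfolding filterlim_at_top by blast
      then have "\<forall>\<^sub>F k in sequentially. \<phi> a k x = 0"
        by eventually_elim (simp add: \<phi>_def algebra_simps)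
      then show ?thesis using 3 by (auto intro: tendsto_eventually)
    qed
  qed
  have step: "(\<lambda>k. LINT \<omega>|N. \<phi> a k (Z0 \<omega>)) \<longlonglongrightarrow> measure N A"
    if "A \<in> sets N" "\<And>\<omega>. \<omega> \<in> space N \<Longrightarrow> indicator A \<omega> = (if Z0 \<omega> > c then 1 else if Z0 \<omega> = c then min 1 (max 0 a) else 0 :: real)" for a A
  proof -
    note that(1)[measurable]
    have "(\<lambda>k. LINT \<omega>|N. \<phi> a k (Z0 \<omega>)) \<longlonglongrightarrow> (LINT \<omega>|N. indicator A \<omega>)"
    proof (rule integral_dominated_convergence[where w="\<lambda>_. 1"])
      show "AE \<omega> in N. (\<lambda>k. \<phi> a k (Z0 \<omega>)) \<longlonglongrightarrow> indicator A \<omega>"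
        by (rule AE_I2) (simp only: that(2) pt)
    qed (use \<phi>_bounds in auto)
    then show ?thesis using sets.sets_into_space[OF that(1)] by (simp add: Int_absorb2)
  qed
  show ?upper
  proof -
    let ?A = "{\<omega> \<in> space N. Z0 \<omega> \<ge> c}"
    have "(\<lambda>k. LINT \<omega>|N. \<phi> 1 k (Z0 \<omega>)) \<longlonglongrightarrow> measure N ?A"
      by (rule step) auto
    then have "\<forall>\<^sub>F k in sequentially. (LINT \<omega>|N. \<phi> 1 k (Z0 \<omega>)) < measure N ?A + e"
      by (rule order_tendstoD) (use \<open>e > 0\<close> in simp)
    then obtain k where "(LINT \<omega>|N. \<phi> 1 k (Z0 \<omega>)) < measure N ?A + e"
      by (auto simp: eventually_sequentially)
    with lim have "\<forall>\<^sub>F i in F. (LINT \<omega>|M. \<phi> 1 k (Z i \<omega>)) < measure N ?A + e"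
      by (rule order_tendstoD)
    with Z show ?thesis
    proof eventually_elim
      case (elim i)
      note elim(1)[measurable]
      have "measure M {\<omega> \<in> space M. Z i \<omega> > c} = (LINT \<omega>|M. indicator {\<omega> \<in> space M. Z i \<omega> > c} \<omega>)"
        by (simp add: Int_absorb2 subset_iff)
      also have "\<dots> \<le> (LINT \<omega>|M. \<phi> 1 k (Z i \<omega>))"
      proof (rule integral_mono)
        show "indicator {\<omega> \<in> space M. Z i \<omega> > c} \<omega> \<le> \<phi> 1 k (Z i \<omega>)" for \<omega>
          by (auto simp: \<phi>_def indicator_def)
      qed (rule integrable_real_indicator int[OF M.prob_space_axioms elim(1)] | simp add: M.emeasure_eq_measure)+
      finally show ?case using elim(2) by simp
    qed
  qed
  show ?lower
  proof -
    let ?A = "{\<omega> \<in> space N. Z0 \<omega> > c}"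
    have "(\<lambda>k. LINT \<omega>|N. \<phi> 0 k (Z0 \<omega>)) \<longlonglongrightarrow> measure N ?A"
      by (rule step) auto
    then have "\<forall>\<^sub>F k in sequentially. (LINT \<omega>|N. \<phi> 0 k (Z0 \<omega>)) > measure N ?A - e"
      by (rule order_tendstoD) (use \<open>e > 0\<close> in simp)
    then obtain k where "(LINT \<omega>|N. \<phi> 0 k (Z0 \<omega>)) > measure N ?A - e"
      by (auto simp: eventually_sequentially)
    with lim have "\<forall>\<^sub>F i in F. (LINT \<omega>|M. \<phi> 0 k (Z i \<omega>)) > measure N ?A - e"
      by (rule order_tendstoD)
    with Z show ?thesis
    proof eventually_elim
      case (elim i)
      note elim(1)[measurable]
      have "(LINT \<omega>|M. \<phi> 0 k (Z i \<omega>)) \<le> (LINT \<omega>|M. indicator {\<omega> \<in> space M. Z i \<omega> > c} \<omega>)"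
      proof (rule integral_mono)
        show "\<phi> 0 k (Z i \<omega>) \<le> indicator {\<omega> \<in> space M. Z i \<omega> > c} \<omega>" if "\<omega> \<in> space M" for \<omega>
          using that by (auto simp: \<phi>_def indicator_def mult_le_0_iff)
      qed (rule integrable_real_indicator int[OF M.prob_space_axioms elim(1)] | simp add: M.emeasure_eq_measure)+
      also have "\<dots> = measure M {\<omega> \<in> space M. Z i \<omega> > c}"
        by (simp add: Int_absorb2 subset_iff)
      finally show ?case using elim(2) by simp
    qed
  qed
qed

lemma converges_in_distribution_tail:
  fixes Z0 :: "'b \<Rightarrow> real"
  assumes "prob_space M" "prob_space N" and conv: "converges_in_distribution F M Z N Z0"
    and no_atom: "measure N {\<omega> \<in> space N. Z0 \<omega> = c} = 0"
  shows "((\<lambda>i. measure M {\<omega> \<in> space M. Z i \<omega> > c}) \<longlongrightarrow> measure N {\<omega> \<in> space N. Z0 \<omega> > c}) F"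
proof (rule tendstoI)
  fix e :: real assume "e > 0"
  interpret N: prob_space N by fact
  have [measurable]: "Z0 \<in> borel_measurable N"
    using conv by (simp add: converges_in_distribution_def)
  have "measure N {\<omega> \<in> space N. Z0 \<omega> \<ge> c} =
      measure N {\<omega> \<in> space N. Z0 \<omega> > c} + measure N {\<omega> \<in> space N. Z0 \<omega> = c}"
    by (subst N.finite_measure_Union[symmetric]) (auto intro!: arg_cong2[where f=measure])
  with no_atom have eq: "measure N {\<omega> \<in> space N. Z0 \<omega> \<ge> c} = measure N {\<omega> \<in> space N. Z0 \<omega> > c}"
    by simp
  show "\<forall>\<^sub>F i in F. dist (measure M {\<omega> \<in> space M. Z i \<omega> > c}) (measure N {\<omega> \<in> space N. Z0 \<omega> > c}) < e"
    using converges_in_distribution_tail_bounds[OF assms(1-3) \<open>e > 0\<close>, of c] unfolding eq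
    by eventually_elim (simp add: dist_real_def)
qed

lemma (in prob_space) upper_tail_limits:
  fixes Z :: "'a \<Rightarrow> real"
  assumes [measurable]: "Z \<in> borel_measurable M"
  shows "((\<lambda>x. measure M {\<omega> \<in> space M. Z \<omega> > x}) \<longlongrightarrow> 0) at_top"
    and "((\<lambda>x. measure M {\<omega> \<in> space M. Z \<omega> > x}) \<longlongrightarrow> 1) at_bot"
proof -
  interpret D: real_distribution "distr M borel Z" by (rule real_distribution_distr) simp
  have tail: "measure M {\<omega> \<in> space M. Z \<omega> > x} = 1 - cdf (distr M borel Z) x" for x
  proof -
    have "cdf (distr M borel Z) x = measure M {\<omega> \<in> space M. Z \<omega> \<le> x}"
      by (auto simp: cdf_def measure_distr intro!: arg_cong2[where f=measure])
    moreover have "measure M {\<omega> \<in> space M. Z \<omega> > x} = 1 - measure M {\<omega> \<in> space M. Z \<omega> \<le> x}"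
      by (subst prob_neg[symmetric]) (auto simp: not_le)
    ultimately show ?thesis by simp
  qed
  show "((\<lambda>x. measure M {\<omega> \<in> space M. Z \<omega> > x}) \<longlongrightarrow> 0) at_top"
    using tendsto_diff[OF tendsto_const D.cdf_lim_at_top_prob, of 1] by (simp add: tail)
  show "((\<lambda>x. measure M {\<omega> \<in> space M. Z \<omega> > x}) \<longlongrightarrow> 1) at_bot"
    using tendsto_diff[OF tendsto_const D.cdf_lim_at_bot, of 1] by (simp add: tail)
qed

text \<open>
  Variables that converge in distribution are tight, so almost no mass lies beyond a threshold that
  escapes to infinity. It suffices to compare \<open>c i\<close> with one fixed level at which the tail of the
  limit is already close to its own limit.
\<close>

lemma converges_in_distribution_tail_diverging:
  fixes Z0 :: "'b \<Rightarrow> real"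
  assumes M: "prob_space M" and N: "prob_space N" and conv: "converges_in_distribution F M Z N Z0"
  shows "filterlim c at_top F \<Longrightarrow> ((\<lambda>i. measure M {\<omega> \<in> space M. Z i \<omega> > c i}) \<longlongrightarrow> 0) F" (is "_ \<Longrightarrow> ?vanish")
    and "filterlim c at_bot F \<Longrightarrow> ((\<lambda>i. measure M {\<omega> \<in> space M. Z i \<omega> > c i}) \<longlongrightarrow> 1) F" (is "_ \<Longrightarrow> ?full")
proof -
  interpret M: prob_space M by fact
  interpret N: prob_space N by fact
  have Z: "\<forall>\<^sub>F i in F. Z i \<in> borel_measurable M" and Z0[measurable]: "Z0 \<in> borel_measurable N"
    using conv by (auto simp: converges_in_distribution_def)
  have mono: "measure M {\<omega> \<in> space M. Z i \<omega> > b} \<le> measure M {\<omega> \<in> space M. Z i \<omega> > a}"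
    if "a \<le> b" "Z i \<in> borel_measurable M" for a b i
    using that by (intro M.finite_measure_mono) auto
  show ?vanish if c: "filterlim c at_top F"
  proof (rule tendstoI)
    fix e :: real assume "e > 0"
    have "\<forall>\<^sub>F x in at_top. measure N {\<omega> \<in> space N. Z0 \<omega> > x} < e / 2"
      using \<open>e > 0\<close> by (intro order_tendstoD(2)[OF N.upper_tail_limits(1)[OF Z0]]) simp
    then obtain K where K: "measure N {\<omega> \<in> space N. Z0 \<omega> > K} < e / 2"
      by (auto simp: eventually_at_top_linorder)
    have K1: "measure N {\<omega> \<in> space N. Z0 \<omega> \<ge> K + 1} \<le> measure N {\<omega> \<in> space N. Z0 \<omega> > K}"
      by (intro N.finite_measure_mono) auto
    have "\<forall>\<^sub>F i in F. K + 1 \<le> c i" using c by (simp add: filterlim_at_top)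
    with Z converges_in_distribution_tail_bounds(1)[OF M N conv, of "e / 2" "K + 1"] \<open>e > 0\<close>
    show "\<forall>\<^sub>F i in F. dist (measure M {\<omega> \<in> space M. Z i \<omega> > c i}) 0 < e"
    proof (simp, elim eventually_rev_mp, intro always_eventually allI impI)
      fix i assume a: "K + 1 \<le> c i" "Z i \<in> borel_measurable M"
        and b: "measure M {\<omega> \<in> space M. K + 1 < Z i \<omega>} < measure N {\<omega> \<in> space N. K + 1 \<le> Z0 \<omega>} + e / 2"
      show "measure M {\<omega> \<in> space M. c i < Z i \<omega>} < e"
        using mono[OF a] b K K1 by linarith
    qed
  qed
  show ?full if c: "filterlim c at_bot F"
  proof (rule tendstoI)
    fix e :: real assume "e > 0"
    have "\<forall>\<^sub>F x in at_bot. measure N {\<omega> \<in> space N. Z0 \<omega> > x} > 1 - e / 2"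
      using \<open>e > 0\<close> by (intro order_tendstoD(1)[OF N.upper_tail_limits(2)[OF Z0]]) simp
    then obtain K where K: "measure N {\<omega> \<in> space N. Z0 \<omega> > K} > 1 - e / 2"
      by (auto simp: eventually_at_bot_linorder)
    have cK: "\<forall>\<^sub>F i in F. c i \<le> K" using c by (simp add: filterlim_at_bot)
    have "\<forall>\<^sub>F i in F. measure M {\<omega> \<in> space M. Z i \<omega> > K} > measure N {\<omega> \<in> space N. Z0 \<omega> > K} - e / 2"
      using \<open>e > 0\<close> by (intro converges_in_distribution_tail_bounds(2)[OF M N conv]) simp
    with Z cK show "\<forall>\<^sub>F i in F. dist (measure M {\<omega> \<in> space M. Z i \<omega> > c i}) 1 < e"
    proof eventually_elim
      case (elim i)
      have "measure M {\<omega> \<in> space M. Z i \<omega> > c i} \<le> 1" by simp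
      then show ?case
        using mono[OF elim(2,1)] elim(3) K unfolding dist_real_def by linarith
    qed
  qed
qed

text \<open>
  A continuous distribution function attains the level \<open>p\<close> at the quantile: the set
  whose infimum is taken is closed, which gives \<open>\<ge>\<close>, and approaching the infimum from the left gives \<open>\<le>\<close>.
\<close>

lemma (in real_distribution) cdf_quantile:
  assumes no_atoms: "\<And>x. measure M {x} = 0" and p: "0 < p" "p < 1"
  shows "cdf M (quantile M p) = p"
proof -
  let ?S = "{x. p \<le> cdf M x}"
  have cont: "continuous_on UNIV (cdf M)"
    by (simp add: continuous_on_eq_continuous_at isCont_cdf no_atoms)
  obtain a where a: "\<And>x. x \<le> a \<Longrightarrow> cdf M x < p"
    using order_tendstoD(2)[OF cdf_lim_at_bot \<open>0 < p\<close>] by (auto simp: eventually_at_bot_linorder)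
  obtain b where b: "p < cdf M b"
    using order_tendstoD(1)[OF cdf_lim_at_top_prob \<open>p < 1\<close>] by (auto simp: eventually_at_top_linorder)
  have bdd: "bdd_below ?S"
    using a by (intro bdd_belowI[of _ a]) (smt (verit) mem_Collect_eq)
  have "closed ?S" by (intro closed_Collect_le continuous_on_const cont)
  then have "Inf ?S \<in> ?S"
    using b bdd by (intro closed_contains_Inf) (auto intro: less_imp_le)
  moreover have "cdf M (Inf ?S) \<le> p"
  proof (rule tendsto_upperbound)
    show "(cdf M \<longlongrightarrow> cdf M (Inf ?S)) (at_left (Inf ?S))"
      using cont by (auto simp: continuous_on_eq_continuous_at isCont_def intro: filterlim_mono[OF _ order_refl at_le])
    show "\<forall>\<^sub>F x in at_left (Inf ?S). cdf M x \<le> p"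
    proof (rule eventually_at_leftI[of "Inf ?S - 1"])
      fix x assume "x \<in> {Inf ?S - 1<..<Inf ?S}"
      then show "cdf M x \<le> p"
        using cInf_lower[OF _ bdd, of x] by force
    qed simp
  qed simp
  ultimately show ?thesis unfolding quantile_def by simp
qed

section \<open>Limits of the rejection probability\<close>

theorem theorem2p1:
  fixes M :: "'a measure" and N :: "'b measure"
    and X Y :: "int \<Rightarrow> 'a \<Rightarrow> real \<Rightarrow> real"
    and \<tau>X \<tau>Y :: "nat \<Rightarrow> real"
    and vX vY :: "nat \<Rightarrow> real \<Rightarrow> real"
    and vhatX vhatY :: "nat \<Rightarrow> nat \<Rightarrow> 'a \<Rightarrow> real \<Rightarrow> real \<Rightarrow> real"
    and \<nu> :: "real measure"
    and B :: "real \<Rightarrow> 'b \<Rightarrow> real"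
    and F :: "(nat \<times> nat) filter"
    and j :: nat
    and \<Delta> \<alpha> \<zeta> D q :: real
    and reject_prob :: "nat \<times> nat \<Rightarrow> real"
  assumes "prob_space M"
    and "L2_time_series M X" and "L2_time_series M Y"
    and "independent_series M X Y"
    and "stationary M X" and "stationary M Y"
    and "centred M X" and "centred M Y"
    and "finite_second_moments M X" and "finite_second_moments M Y"
    and "eigensystem (cov_kernel M X) \<tau>X vX"
    and "eigensystem (cov_kernel M Y) \<tau>Y vY"
    and "\<And>k. k \<ge> 1 \<Longrightarrow> L2_inner (vX k) (vY k) \<ge> 0"
    and "j \<ge> 1" and "\<Delta> > 0" and "0 < \<alpha>" and "\<alpha> < 1"
    and "D = (L2_norm (\<lambda>t. vX j t - vY j t))\<^sup>2"
    and "\<And>m n \<omega> l. \<omega> \<in> space M \<Longrightarrow> l \<in> {0..1} \<Longrightarrow>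
           unit_eigenfunction (emp_kernel (\<lambda>k. X k \<omega>) m l) j (vhatX m n \<omega> l)"
    and "\<And>m n \<omega> l. \<omega> \<in> space M \<Longrightarrow> l \<in> {0..1} \<Longrightarrow>
           unit_eigenfunction (emp_kernel (\<lambda>k. Y k \<omega>) n l) j (vhatY m n \<omega> l)"
    and "\<And>m n \<omega> l. \<omega> \<in> space M \<Longrightarrow> l \<in> {0..1} \<Longrightarrow>
           L2_inner (vhatX m n \<omega> l) (vhatY m n \<omega> l) \<ge> 0"
    and "prob_space \<nu>" and "sets \<nu> = sets (restrict_space borel {0<..1})"
    and "std_brownian_motion N B"
    and "AE \<omega> in N. bridge_integral \<nu> B \<omega> > 0"
    and "sample_sizes_to_infinity F"
    and "\<zeta> \<ge> 0" and "D > 0 \<Longrightarrow> \<zeta> > 0"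
    and "converges_in_distribution F
           M (\<lambda>(m, n) \<omega>.
                (sqrt (real (m + n)) * (Dhat (vhatX m n \<omega>) (vhatY m n \<omega>) - D),
                 sqrt (real (m + n)) * Vhat \<nu> (vhatX m n \<omega>) (vhatY m n \<omega>)))
           N (\<lambda>\<omega>. (\<zeta> * B 1 \<omega>, sqrt (\<zeta>\<^sup>2 * bridge_integral \<nu> B \<omega>)))"
    and "q = quantile (distr N borel (limit_W \<nu> B)) (1 - \<alpha>)"
    and "\<And>m n. reject_prob (m, n) =
           measure M {\<omega> \<in> space M. rejects \<nu> \<Delta> q (vhatX m n \<omega>) (vhatY m n \<omega>)}"
  shows "asymptotic_level F \<alpha> (D \<le> \<Delta>) reject_prob
       \<and> consistent_test F (D > \<Delta>) reject_prob
       \<and> (reject_prob \<longlongrightarrow> (if D < \<Delta> then 0 else if D = \<Delta> then \<alpha> else 1)) F"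
proof -
  interpret M: prob_space M by fact
  interpret N: prob_space N using assms(24) by (simp add: std_brownian_motion_def)
  have bm: "std_brownian_motion N B" and \<nu>: "prob_space \<nu>" "sets \<nu> = sets (restrict_space borel {0<..1})"
    and V_pos: "AE \<omega> in N. bridge_integral \<nu> B \<omega> > 0" by fact+
  have [measurable]: "B 1 \<in> borel_measurable N"
    using bm by (simp add: std_brownian_motion_def)
  define s where "s p = sqrt (real (fst p + snd p))" for p :: "nat \<times> nat"
  define Z where "Z p \<omega> = s p * (Dhat (vhatX (fst p) (snd p) \<omega>) (vhatY (fst p) (snd p) \<omega>) - D) -
      q * (s p * Vhat \<nu> (vhatX (fst p) (snd p) \<omega>) (vhatY (fst p) (snd p) \<omega>))" for p \<omega>
  define Z0 where "Z0 \<omega> = \<zeta> * B 1 \<omega> - q * sqrt (\<zeta>\<^sup>2 * bridge_integral \<nu> B \<omega>)" for \<omega>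
  note conv2 = assms(29)
  have conv: "converges_in_distribution F M Z N Z0"
    using converges_in_distribution_continuous_map[OF conv2, of "\<lambda>x. fst x - q * snd x"]
    unfolding Z_def Z0_def s_def by (simp add: case_prod_beta' continuous_intros)
  have m: "filterlim fst at_top F"
    using assms(26) by (simp add: sample_sizes_to_infinity_def)
  have s_top: "filterlim s at_top F"
    unfolding s_def
  proof (rule filterlim_compose[OF sqrt_at_top], rule filterlim_compose[OF filterlim_real_sequentially])
    show "filterlim (\<lambda>p. fst p + snd p) sequentially F"
      by (rule filterlim_at_top_mono[OF m]) simp
  qed
  have reject_eq: "\<forall>\<^sub>F p in F. measure M {\<omega> \<in> space M. Z p \<omega> > s p * (\<Delta> - D)} = reject_prob p"
  proof -
    have "\<forall>\<^sub>F p in F. 0 < s p"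
      using s_top unfolding filterlim_at_top_dense by blast
    then show ?thesis
    proof eventually_elim
      case (elim p)
      have "Z p \<omega> > s p * (\<Delta> - D) \<longleftrightarrow> rejects \<nu> \<Delta> q (vhatX (fst p) (snd p) \<omega>) (vhatY (fst p) (snd p) \<omega>)" for \<omega>
      proof -
        let ?d = "Dhat (vhatX (fst p) (snd p) \<omega>) (vhatY (fst p) (snd p) \<omega>)"
        let ?v = "Vhat \<nu> (vhatX (fst p) (snd p) \<omega>) (vhatY (fst p) (snd p) \<omega>)"
        have "Z p \<omega> > s p * (\<Delta> - D) \<longleftrightarrow> s p * (q * ?v) < s p * (?d - \<Delta>)"
          by (simp add: Z_def algebra_simps)
        also have "\<dots> \<longleftrightarrow> q * ?v < ?d - \<Delta>"
          using elim by (rule mult_less_cancel_left_pos)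
        finally show ?thesis by (simp add: rejects_def)
      qed
      then show ?case
        using assms(31)[of "fst p" "snd p"] by simp
    qed
  qed
  have "(reject_prob \<longlongrightarrow> (if D < \<Delta> then 0 else if D = \<Delta> then \<alpha> else 1)) F"
  proof (cases D \<Delta> rule: linorder_cases)
    case less
    have "filterlim (\<lambda>p. s p * (\<Delta> - D)) at_top F"
      using less by (intro filterlim_at_top_mult_tendsto_pos[OF tendsto_const _ s_top]) simp
    from converges_in_distribution_tail_diverging(1)[OF M.prob_space_axioms N.prob_space_axioms conv this]
    show ?thesis using reject_eq less by (simp add: tendsto_cong)
  next
    case greater
    have "filterlim (\<lambda>p. s p * (\<Delta> - D)) at_bot F"
      using greater filterlim_tendsto_neg_mult_at_bot[OF tendsto_const _ s_top, of "\<Delta> - D"]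
      by (simp add: mult.commute)
    from converges_in_distribution_tail_diverging(2)[OF M.prob_space_axioms N.prob_space_axioms conv this]
    show ?thesis using reject_eq greater by (simp add: tendsto_cong)
  next
    case equal
    with \<open>\<Delta> > 0\<close> have "\<zeta> > 0" by (intro assms(28)) simp
    \<comment> \<open>The measurability of the bridge integral is part of the assumed convergence, whose limit variable
      has to be measurable; since \<open>\<zeta> > 0\<close>, the integral can be recovered from that variable.\<close>
    have "(\<lambda>\<omega>. sqrt (\<zeta>\<^sup>2 * bridge_integral \<nu> B \<omega>)) \<in> borel_measurable N"
      using converges_in_distribution_continuous_map[OF conv2, of snd]
      by (simp add: converges_in_distribution_def continuous_on_snd continuous_on_id)
    then have "(\<lambda>\<omega>. (sqrt (\<zeta>\<^sup>2 * bridge_integral \<nu> B \<omega>))\<^sup>2 / \<zeta>\<^sup>2) \<in> borel_measurable N" by measurable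
    moreover have "(sqrt (\<zeta>\<^sup>2 * bridge_integral \<nu> B \<omega>))\<^sup>2 / \<zeta>\<^sup>2 = bridge_integral \<nu> B \<omega>" for \<omega>
    proof -
      have "bridge_integral \<nu> B \<omega> \<ge> 0"
        unfolding bridge_integral_def by (rule Bochner_Integration.integral_nonneg) simp
      then show ?thesis using \<open>\<zeta> > 0\<close> by simp
    qed
    ultimately have V[measurable]: "bridge_integral \<nu> B \<in> borel_measurable N" by simp
    have Z0_eq: "Z0 \<omega> = \<zeta> * (B 1 \<omega> - q * sqrt (bridge_integral \<nu> B \<omega>))" for \<omega>
      using \<open>\<zeta> > 0\<close> by (simp add: Z0_def real_sqrt_mult algebra_simps)
    have "measure N {\<omega> \<in> space N. Z0 \<omega> = 0} = 0"
      using brownian_bridge_ratio_no_atom[OF bm \<nu> V, of q] \<open>\<zeta> > 0\<close> by (simp add: Z0_eq)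
    from converges_in_distribution_tail[OF M.prob_space_axioms N.prob_space_axioms conv this]
    have "(reject_prob \<longlongrightarrow> measure N {\<omega> \<in> space N. Z0 \<omega> > 0}) F"
      using reject_eq equal by (simp add: tendsto_cong)
    moreover have "measure N {\<omega> \<in> space N. Z0 \<omega> > 0} = \<alpha>"
    proof -
      have W[measurable]: "limit_W \<nu> B \<in> borel_measurable N"
        unfolding limit_W_def[abs_def] by measurable
      interpret W: real_distribution "distr N borel (limit_W \<nu> B)"
        by (rule N.real_distribution_distr) simp
      have no_atoms: "measure (distr N borel (limit_W \<nu> B)) {x} = 0" for x
      proof -
        have "measure (distr N borel (limit_W \<nu> B)) {x} = measure N {\<omega> \<in> space N. limit_W \<nu> B \<omega> = x}"
          by (subst measure_distr) (auto intro!: arg_cong2[where f=measure])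
        also have "\<dots> = measure N {\<omega> \<in> space N. B 1 \<omega> = x * sqrt (bridge_integral \<nu> B \<omega>)}"
          using V_pos by (intro N.finite_measure_eq_AE) (auto simp: limit_W_def field_simps)
        finally show ?thesis
          using brownian_bridge_ratio_no_atom[OF bm \<nu> V] by simp
      qed
      have "measure N {\<omega> \<in> space N. Z0 \<omega> > 0} = measure N {\<omega> \<in> space N. \<not> limit_W \<nu> B \<omega> \<le> q}"
        using V_pos \<open>\<zeta> > 0\<close>
        by (intro N.finite_measure_eq_AE) (auto simp: Z0_eq limit_W_def field_simps zero_less_mult_iff)
      also have "\<dots> = 1 - measure N {\<omega> \<in> space N. limit_W \<nu> B \<omega> \<le> q}"
        by (rule N.prob_neg) measurable
      also have "measure N {\<omega> \<in> space N. limit_W \<nu> B \<omega> \<le> q} = cdf (distr N borel (limit_W \<nu> B)) q"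
        by (auto simp: cdf_def measure_distr intro!: arg_cong2[where f=measure])
      also have "\<dots> = 1 - \<alpha>"
        unfolding assms(30) using W.cdf_quantile[OF no_atoms, of "1 - \<alpha>"] assms(16,17) by simp
      finally show ?thesis by simp
    qed
    ultimately show ?thesis using equal by simp
  qed
  moreover from this have "asymptotic_level F \<alpha> (D \<le> \<Delta>) reject_prob"
    unfolding asymptotic_level_def using \<open>0 < \<alpha>\<close>
    by (intro impI exI[of _ "if D < \<Delta> then 0 else if D = \<Delta> then \<alpha> else 1"]) auto
  moreover from calculation have "consistent_test F (D > \<Delta>) reject_prob"
    unfolding consistent_test_def by auto
  ultimately show ?thesis by blast
qed

end
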